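(* Let $x_0\in\mathcal M$ and let $(x_k)_{k\ge 0}\subset\mathcal M$, $d_k\in T_{x_k}\mathcal M$, $t_k>0$ satisfy $x_{k+1}=R_{x_k}(t_kd_k)$ for all $k\ge 0$. Suppose that: (i) there exists a constant $L>0$ such that for all $x\in\mathcal M$, all $d\in T_x\mathcal M$ with $\|d\|=1$ and all $t\ge 0$, $\|\mathrm D(F\circ R_x)(td)[d]-\mathrm D(F\circ R_x)(0)[d]\|\le Lt$; (ii) with $\mathcal L=\{x\in\mathcal M\mid F(x)\preceq_K F(x_0)\}$, whenever $(G_k)_{k\in\mathbb N}\subset F(\mathcal L)$ satisfies $G_{k+1}\preceq_K G_k$ for all $k$, there exists $\mathcal G\in\mathbb R^m$ with $\mathcal G\preceq_K G_k$ for all $k$; (iii) for every $k\ge 0$, $d_k$ is a $K$-descent direction for $F$ at $x_k$, and $t_k$ satisfies the Wolfe conditions $$F(R_{x_k}(t_kd_k))\preceq_K F(x_k)+c_1t_k\,\varphi(\mathrm DF(x_k)[d_k])\,e,$$ $$\varphi\big(\mathrm DF(R_{x_k}(t_kd_k))[\mathrm DR_{x_k}(t_kd_k)[d_k]]\big)\ge c_2\,\varphi(\mathrm DF(x_k)[d_k]).$$ Then $$\sum_{k\ge 0}\frac{\varphi^2(\mathrm DF(x_k)[d_k])}{\|d_k\|^2}<\infty .$$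
   Context: $K\subset\mathbb R^m$ is a closed, convex, pointed ($K\cap(-K)=\{0\}$) cone with nonempty interior; $u\preceq_K v$ means $v-u\in K$. $K^*=\{\omega\in\mathbb R^m\mid \omega^Ty\ge 0\ \text{for all } y\in K\}$, and $C\subset K^*\setminus\{0\}$ is a compact set such that $K^*$ is the cone generated by the convex hull of $C$. $\varphi:\mathbb R^m\to\mathbb R$ is $\varphi(y)=\sup\{y^Tw\mid w\in C\}$. $e\in K$ is a fixed vector with $0<\langle\omega,e\rangle\le 1$ for all $\omega\in C$, and $0<c_1<c_2<1$ are fixed constants. $\mathcal M$ is an $n$-dimensional smooth Riemannian manifold with metric $\langle\cdot,\cdot\rangle$; $\|\cdot\|$ denotes the induced norm on tangent spaces (and the Euclidean norm on $\mathbb R^m$). $F:\mathcal M\to\mathbb R^m$ is continuously differentiable with derivative $\mathrm DF(x):T_x\mathcal M\to\mathbb R^m$. $R:T\mathcal M\to\mathcal M$ is a retraction, i.e. a smooth map whose restrictions $R_x$ to $T_x\mathcal M$ satisfy $R_x(0_x)=x$ and $\mathrm DR_x(0_x)=\mathrm{id}_{T_x\mathcal M}$. A vector $d\in T_x\mathcal M$ is a $K$-descent direction for $F$ at $x$ if $\mathrm DF(x)[d]\in-\operatorname{int}(K)$, equivalently $\varphi(\mathrm DF(x)[d])<0$. *)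

theory Defs
  imports "HOL-Analysis.Analysis"
begin

section \<open>Maps of class \<open>C\<^sup>k\<close> between open subsets of Euclidean spaces\<close>

text \<open>
  Intended for open \<open>S\<close> in a finite-dimensional space. There, continuity of all directional
  derivatives \<open>\<lambda>x. D f x v\<close> is continuity of \<open>D f\<close>; quantifying over the direction keeps the
  type of the map unchanged along the recursion.
\<close>

primrec Ck_on :: "nat \<Rightarrow> 'a::real_normed_vector set \<Rightarrow> ('a \<Rightarrow> 'b::real_normed_vector) \<Rightarrow> bool" where
  "Ck_on 0 S f \<longleftrightarrow> continuous_on S f"
| "Ck_on (Suc k) S f \<longleftrightarrow>
     (\<forall>x\<in>S. f differentiable (at x)) \<and> (\<forall>v. Ck_on k S (\<lambda>x. frechet_derivative f (at x) v))"

definition smooth_on :: "'a::real_normed_vector set \<Rightarrow> ('a \<Rightarrow> 'b::real_normed_vector) \<Rightarrow> bool" where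
  "smooth_on S f \<longleftrightarrow> (\<forall>k. Ck_on k S f)"


section \<open>Smooth manifolds\<close>

text \<open>A chart is a domain together with a coordinate map, whose values off the domain are irrelevant.\<close>

type_synonym ('a, 'e) chart = "'a set \<times> ('a \<Rightarrow> 'e)"

definition chart_inv :: "('a, 'e) chart \<Rightarrow> 'e \<Rightarrow> 'a" where
  "chart_inv c = inv_into (fst c) (snd c)"

definition atlas_carrier :: "('a, 'e) chart set \<Rightarrow> 'a set" where
  "atlas_carrier A = (\<Union>c\<in>A. fst c)"

definition charts_at :: "('a, 'e) chart set \<Rightarrow> 'a \<Rightarrow> ('a, 'e) chart set" where
  "charts_at A x = {c \<in> A. x \<in> fst c}"

text \<open>
  The smooth structure is the one determined by the atlas \<open>A\<close>, which need not be maximal.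
  The dimension is that of the model space \<open>'e\<close>.
\<close>

definition smooth_manifold :: "'a topology \<Rightarrow> ('a, 'e::euclidean_space) chart set \<Rightarrow> bool" where
  "smooth_manifold X A \<longleftrightarrow>
     Hausdorff_space X \<and> second_countable X \<and>
     topspace X = atlas_carrier A \<and>
     (\<forall>c\<in>A. openin X (fst c) \<and> open (snd c ` fst c) \<and>
        homeomorphic_map (subtopology X (fst c)) (top_of_set (snd c ` fst c)) (snd c)) \<and>
     (\<forall>c\<in>A. \<forall>c'\<in>A. smooth_on (snd c ` (fst c \<inter> fst c')) (snd c' \<circ> chart_inv c))"

text \<open>
  Openness of \<open>snd c ` (fst c \<inter> f -` fst c')\<close> for all pairs of charts encodes continuity of \<open>f\<close>.
\<close>

definition Ck_map :: "nat \<Rightarrow> ('a, 'e::real_normed_vector) chart set \<Rightarrow>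
    ('b, 'f::real_normed_vector) chart set \<Rightarrow> ('a \<Rightarrow> 'b) \<Rightarrow> bool" where
  "Ck_map k A B f \<longleftrightarrow>
     f ` atlas_carrier A \<subseteq> atlas_carrier B \<and>
     (\<forall>c\<in>A. \<forall>c'\<in>B. open (snd c ` (fst c \<inter> f -` fst c')) \<and>
        Ck_on k (snd c ` (fst c \<inter> f -` fst c')) (snd c' \<circ> f \<circ> chart_inv c))"

definition smooth_map :: "('a, 'e::real_normed_vector) chart set \<Rightarrow>
    ('b, 'f::real_normed_vector) chart set \<Rightarrow> ('a \<Rightarrow> 'b) \<Rightarrow> bool" where
  "smooth_map A B f \<longleftrightarrow> (\<forall>k. Ck_map k A B f)"

definition std_atlas :: "('e, 'e) chart set" where
  "std_atlas = {(UNIV, \<lambda>y. y)}"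


section \<open>Tangent vectors and derivatives\<close>

text \<open>
  A tangent vector at \<open>x\<close> is the family of its coordinate vectors in all charts around \<open>x\<close>, related
  by the Jacobians of the coordinate changes. Families are \<open>0\<close> at all other charts, so that equality
  of tangent vectors is equality of functions and the vector space operations are pointwise.
\<close>

type_synonym ('a, 'e) tvec = "('a, 'e) chart \<Rightarrow> 'e"

definition tangent_space :: "('a, 'e::real_normed_vector) chart set \<Rightarrow> 'a \<Rightarrow> ('a, 'e) tvec set" where
  "tangent_space A x =
     {v. (\<forall>c\<in>charts_at A x. \<forall>c'\<in>charts_at A x.
            v c' = frechet_derivative (snd c' \<circ> chart_inv c) (at (snd c x)) (v c)) \<and>
         (\<forall>c. c \<notin> charts_at A x \<longrightarrow> v c = 0)}"

definition tzero :: "('a, 'e::real_normed_vector) tvec" where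
  "tzero = (\<lambda>c. 0)"

definition tadd :: "('a, 'e::real_normed_vector) tvec \<Rightarrow> ('a, 'e) tvec \<Rightarrow> ('a, 'e) tvec" where
  "tadd v w = (\<lambda>c. v c + w c)"

definition tscale :: "real \<Rightarrow> ('a, 'e::real_normed_vector) tvec \<Rightarrow> ('a, 'e) tvec" where
  "tscale t v = (\<lambda>c. t *\<^sub>R v c)"

text \<open>
  \<open>vderiv A F x v\<close> is \<open>DF(x)[v]\<close> for \<open>F\<close> with values in a vector space. The choice of chart is
  immaterial for \<open>F\<close> differentiable at \<open>x\<close> and \<open>v \<in> tangent_space A x\<close>, by the chain rule.
\<close>

definition vderiv :: "('a, 'e::real_normed_vector) chart set \<Rightarrow> ('a \<Rightarrow> 'b::real_normed_vector) \<Rightarrow>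
    'a \<Rightarrow> ('a, 'e) tvec \<Rightarrow> 'b" where
  "vderiv A F x v =
     (let c = (SOME c. c \<in> charts_at A x)
      in frechet_derivative (F \<circ> chart_inv c) (at (snd c x)) (v c))"

text \<open>The differential \<open>Df(x)[v] \<in> T\<^bsub>f(x)\<^esub>N\<close> of a map into a manifold with atlas \<open>B\<close>.\<close>

definition mderiv :: "('a, 'e::real_normed_vector) chart set \<Rightarrow> ('b, 'f::real_normed_vector) chart set \<Rightarrow>
    ('a \<Rightarrow> 'b) \<Rightarrow> 'a \<Rightarrow> ('a, 'e) tvec \<Rightarrow> ('b, 'f) tvec" where
  "mderiv A B f x v = (\<lambda>c'. if c' \<in> charts_at B (f x) then vderiv A (snd c' \<circ> f) x v else 0)"


section \<open>Tangent spaces and the tangent bundle as manifolds\<close>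

definition tangent_bundle_atlas :: "('a, 'e::real_normed_vector) chart set \<Rightarrow>
    ('a \<times> ('a, 'e) tvec, 'e \<times> 'e) chart set" where
  "tangent_bundle_atlas A =
     (\<lambda>c. ({(x, v). x \<in> fst c \<and> v \<in> tangent_space A x}, \<lambda>(x, v). (snd c x, v c))) ` A"

text \<open>The vector space \<open>T\<^sub>xM\<close> as a manifold; every chart around \<open>x\<close> gives global linear coordinates.\<close>

definition tangent_space_atlas :: "('a, 'e::real_normed_vector) chart set \<Rightarrow> 'a \<Rightarrow>
    (('a, 'e) tvec, 'e) chart set" where
  "tangent_space_atlas A x = (\<lambda>c. (tangent_space A x, \<lambda>v. v c)) ` charts_at A x"

text \<open>The canonical identification of \<open>T\<^sub>xM\<close> with the tangent space of \<open>T\<^sub>xM\<close> at any of its points.\<close>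

definition tangent_ident :: "('a, 'e::real_normed_vector) chart set \<Rightarrow> 'a \<Rightarrow> ('a, 'e) tvec \<Rightarrow>
    (('a, 'e) tvec, 'e) tvec" where
  "tangent_ident A x w = (\<lambda>C. if C \<in> tangent_space_atlas A x then snd C w else 0)"

text \<open>
  For a map \<open>G\<close> defined on \<open>T\<^sub>xM\<close> with values in a vector space or in the manifold with atlas \<open>B\<close>:
  \<open>DG(v)[w]\<close> with \<open>v, w \<in> T\<^sub>xM\<close>.
\<close>

definition fibre_vderiv :: "('a, 'e::real_normed_vector) chart set \<Rightarrow> 'a \<Rightarrow>
    (('a, 'e) tvec \<Rightarrow> 'b::real_normed_vector) \<Rightarrow> ('a, 'e) tvec \<Rightarrow> ('a, 'e) tvec \<Rightarrow> 'b" where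
  "fibre_vderiv A x G v w = vderiv (tangent_space_atlas A x) G v (tangent_ident A x w)"

definition fibre_mderiv :: "('a, 'e::real_normed_vector) chart set \<Rightarrow> 'a \<Rightarrow>
    ('b, 'f::real_normed_vector) chart set \<Rightarrow>
    (('a, 'e) tvec \<Rightarrow> 'b) \<Rightarrow> ('a, 'e) tvec \<Rightarrow> ('a, 'e) tvec \<Rightarrow> ('b, 'f) tvec" where
  "fibre_mderiv A x B G v w = mderiv (tangent_space_atlas A x) B G v (tangent_ident A x w)"


section \<open>Riemannian metrics and retractions\<close>

text \<open>The tangent vector at \<open>x\<close> with coordinates \<open>a\<close> in the chart \<open>c\<close>.\<close>

definition coord_vec :: "('a, 'e::real_normed_vector) chart set \<Rightarrow> ('a, 'e) chart \<Rightarrow> 'a \<Rightarrow> 'e \<Rightarrow>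
    ('a, 'e) tvec" where
  "coord_vec A c x a = inv_into (tangent_space A x) (\<lambda>v. v c) a"

definition riemannian_metric :: "('a, 'e::real_normed_vector) chart set \<Rightarrow>
    ('a \<Rightarrow> ('a, 'e) tvec \<Rightarrow> ('a, 'e) tvec \<Rightarrow> real) \<Rightarrow> bool" where
  "riemannian_metric A g \<longleftrightarrow>
     (\<forall>x\<in>atlas_carrier A. \<forall>u\<in>tangent_space A x. \<forall>v\<in>tangent_space A x.
        g x u v = g x v u \<and>
        (\<forall>w\<in>tangent_space A x. g x (tadd u v) w = g x u w + g x v w) \<and>
        (\<forall>r. g x (tscale r u) v = r * g x u v) \<and>
        (u \<noteq> tzero \<longrightarrow> g x u u > 0)) \<and>
     (\<forall>c\<in>A. \<forall>a b. smooth_on (snd c ` fst c)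
        (\<lambda>p. g (chart_inv c p) (coord_vec A c (chart_inv c p) a) (coord_vec A c (chart_inv c p) b)))"

definition metric_norm :: "('a \<Rightarrow> ('a, 'e) tvec \<Rightarrow> ('a, 'e) tvec \<Rightarrow> real) \<Rightarrow> 'a \<Rightarrow>
    ('a, 'e) tvec \<Rightarrow> real" where
  "metric_norm g x v = sqrt (g x v v)"

definition manifold_retraction :: "('a, 'e::real_normed_vector) chart set \<Rightarrow>
    ('a \<times> ('a, 'e) tvec \<Rightarrow> 'a) \<Rightarrow> bool" where
  "manifold_retraction A R \<longleftrightarrow>
     smooth_map (tangent_bundle_atlas A) A R \<and>
     (\<forall>x\<in>atlas_carrier A. R (x, tzero) = x \<and>
        (\<forall>w\<in>tangent_space A x. fibre_mderiv A x A (\<lambda>u. R (x, u)) tzero w = w))"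


section \<open>Cones\<close>

definition cone_le :: "'b::real_vector set \<Rightarrow> 'b \<Rightarrow> 'b \<Rightarrow> bool" where
  "cone_le K u v \<longleftrightarrow> v - u \<in> K"

definition dual_cone :: "'b::real_inner set \<Rightarrow> 'b set" where
  "dual_cone K = {w. \<forall>y\<in>K. w \<bullet> y \<ge> 0}"

definition support_fun :: "'b::real_inner set \<Rightarrow> 'b \<Rightarrow> real" where
  "support_fun C y = (SUP w\<in>C. y \<bullet> w)"

definition K_descent_direction :: "('a, 'e::real_normed_vector) chart set \<Rightarrow>
    'b::real_normed_vector set \<Rightarrow> ('a \<Rightarrow> 'b) \<Rightarrow> 'a \<Rightarrow> ('a, 'e) tvec \<Rightarrow> bool" where
  "K_descent_direction A K F x d \<longleftrightarrow>
     d \<in> tangent_space A x \<and> vderiv A F x d \<in> uminus ` interior K"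

end

theory Submission
  imports Defs
begin

text \<open>
  The curvature condition and the Lipschitz bound force a lower bound on the step,
  \<open>t\<^sub>k \<ge> const \<cdot> (- \<phi>\<^sub>k) / \<parallel>d\<^sub>k\<parallel>\<^sup>2\<close> with \<open>\<phi>\<^sub>k = \<phi>(DF(x\<^sub>k)[d\<^sub>k]) < 0\<close>: the chain rule identifies the two
  derivatives of \<open>F\<close> with derivatives of \<open>F \<circ> R\<^sub>x\<close> along the fibre, and \<open>\<phi>\<close> is Lipschitz.
  Pairing the sufficient decrease condition with a single \<open>\<omega> \<in> C\<close> makes \<open>\<langle>\<omega>, F(x\<^sub>k)\<rangle>\<close> a
  decreasing sequence, bounded below, with decrements at least \<open>const \<cdot> t\<^sub>k (- \<phi>\<^sub>k)\<close>, so
  \<open>\<phi>\<^sub>k\<^sup>2 / \<parallel>d\<^sub>k\<parallel>\<^sup>2 \<le> const \<cdot> t\<^sub>k (- \<phi>\<^sub>k)\<close> is summable by telescoping.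
\<close>

section \<open>Support functions and cones\<close>

lemma support_fun_attained:
  fixes C :: "'b::real_inner set"
  assumes "compact C" "C \<noteq> {}"
  obtains w where "w \<in> C" "support_fun C y = y \<bullet> w" "\<And>v. v \<in> C \<Longrightarrow> y \<bullet> v \<le> y \<bullet> w"
proof -
  have "continuous_on C (\<lambda>w. y \<bullet> w)"
    by (intro continuous_intros)
  then obtain w where w: "w \<in> C" "\<And>v. v \<in> C \<Longrightarrow> y \<bullet> v \<le> y \<bullet> w"
    using continuous_attains_sup[OF assms] by blast
  then have "support_fun C y = y \<bullet> w"
    unfolding support_fun_def by (intro cSup_eq_maximum) auto
  with w show ?thesis
    using that by blast
qed

text \<open>The functional attaining the supremum for \<open>a\<close> is an admissible competitor
  for \<open>b\<close>, so Cauchy-Schwarz bounds the difference and \<open>M\<close> is a Lipschitz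
  constant of \<open>support_fun C\<close>.\<close>

lemma support_fun_diff_le:
  fixes C :: "'b::real_inner set"
  assumes C: "compact C" "C \<noteq> {}" and M: "\<And>w. w \<in> C \<Longrightarrow> norm w \<le> M"
  shows "support_fun C a - support_fun C b \<le> M * norm (a - b)"
proof -
  obtain w where w: "w \<in> C" "support_fun C a = a \<bullet> w"
    using support_fun_attained[OF C] by metis
  obtain w' where w': "support_fun C b = b \<bullet> w'" "\<And>v. v \<in> C \<Longrightarrow> b \<bullet> v \<le> b \<bullet> w'"
    using support_fun_attained[OF C] by metis
  have "support_fun C a - support_fun C b \<le> (a - b) \<bullet> w"
    using w w'(1) w'(2)[OF w(1)] by (simp add: inner_diff_left)
  also have "\<dots> \<le> norm (a - b) * norm w"
    by (rule norm_cauchy_schwarz)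
  also have "\<dots> \<le> norm (a - b) * M"
    using M[OF w(1)] by (intro mult_left_mono) auto
  finally show ?thesis
    by (simp add: mult.commute)
qed

text \<open>An interior point can be moved slightly along \<open>- w\<close> without leaving
  \<open>K\<close>. The move lowers the pairing with \<open>w\<close> by a positive multiple of
  \<open>w \<bullet> w\<close>, and the result is still nonnegative.\<close>

lemma dual_cone_inner_interior_pos:
  fixes K :: "'b::real_inner set"
  assumes "z \<in> interior K" "w \<in> dual_cone K" "w \<noteq> 0"
  shows "z \<bullet> w > 0"
proof -
  obtain \<epsilon> where \<epsilon>: "\<epsilon> > 0" "ball z \<epsilon> \<subseteq> K"
    using assms(1) mem_interior by blast
  \<comment> \<open>This scaling gives the displacement length \<open>\<epsilon> / 2\<close>, which
    keeps the moved point inside the ball.\<close>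
  define \<delta> where "\<delta> = \<epsilon> / (2 * norm w)"
  have "\<delta> > 0"
    using \<epsilon> assms(3) by (simp add: \<delta>_def)
  have "dist z (z - \<delta> *\<^sub>R w) = \<epsilon> / 2"
    using \<epsilon> assms(3) by (simp add: dist_norm \<delta>_def)
  then have "z - \<delta> *\<^sub>R w \<in> K"
    using \<epsilon> by auto
  then have "w \<bullet> (z - \<delta> *\<^sub>R w) \<ge> 0"
    using assms(2) by (simp add: dual_cone_def)
  moreover have "\<delta> * (w \<bullet> w) > 0"
    using \<open>\<delta> > 0\<close> assms(3) by simp
  ultimately show ?thesis
    by (simp add: inner_diff_right inner_commute)
qed

text \<open>Compactness turns the supremum into a maximum, so the strict negativity of each single
  pairing survives.\<close>

lemma support_fun_neg:
  fixes C :: "'b::real_inner set"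
  assumes C: "compact C" "C \<noteq> {}" "C \<subseteq> dual_cone K - {0}" and y: "y \<in> uminus ` interior K"
  shows "support_fun C y < 0"
proof -
  obtain w where w: "w \<in> C" "support_fun C y = y \<bullet> w"
    using support_fun_attained[OF C(1,2)] by metis
  obtain z where z: "z \<in> interior K" "y = - z"
    using y by auto
  have "z \<bullet> w > 0"
    using dual_cone_inner_interior_pos[OF z(1), of w] w(1) C(3) by auto
  with w(2) z(2) show ?thesis
    by simp
qed

section \<open>The order induced by the cone\<close>

lemma cone_le_trans:
  assumes "convex K" "cone K" "cone_le K u v" "cone_le K v w"
  shows "cone_le K u w"
proof -
  have "(v - u) + (w - v) \<in> K"
    using assms convex_cone[of K] unfolding cone_le_def by blast
  then show ?thesis
    by (simp add: cone_le_def)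
qed

lemma cone_le_inner:
  assumes "\<omega> \<in> dual_cone K" "cone_le K u v"
  shows "\<omega> \<bullet> u \<le> \<omega> \<bullet> v"
proof -
  have "\<omega> \<bullet> (v - u) \<ge> 0"
    using assms unfolding dual_cone_def cone_le_def by blast
  then show ?thesis
    by (simp add: inner_diff_right)
qed

section \<open>Charts and tangent vectors\<close>

lemma smooth_on_differentiable:
  assumes "smooth_on S f" "p \<in> S"
  shows "f differentiable (at p)"
proof -
  have "Ck_on (Suc 0) S f"
    using assms(1) unfolding smooth_on_def by blast
  then show ?thesis
    using assms(2) by simp
qed

context
  fixes X :: "'a topology" and A :: "('a, 'e::euclidean_space) chart set"
  assumes M: "smooth_manifold X A"
begin

lemma chart_inv_apply:
  assumes "c \<in> A" "z \<in> fst c"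
  shows "chart_inv c (snd c z) = z"
proof -
  have "openin X (fst c)"
    "homeomorphic_map (subtopology X (fst c)) (top_of_set (snd c ` fst c)) (snd c)"
    using M assms unfolding smooth_manifold_def by auto
  then have "inj_on (snd c) (fst c)"
    using homeomorphic_imp_injective_map[of "subtopology X (fst c)"]
      topspace_subtopology_subset[OF openin_subset] by metis
  then show ?thesis
    using assms by (simp add: chart_inv_def)
qed

text \<open>Supplies open neighbourhoods on which coordinate expressions agreeing only over a chart
  overlap may be exchanged under the derivative.\<close>

lemma open_chart_image:
  assumes "c \<in> A" "openin X U" "U \<subseteq> fst c"
  shows "open (snd c ` U)"
proof -
  have c: "open (snd c ` fst c)"
    "homeomorphic_map (subtopology X (fst c)) (top_of_set (snd c ` fst c)) (snd c)"
    using M assms unfolding smooth_manifold_def by auto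
  have "openin (subtopology X (fst c)) U"
    using assms by (simp add: openin_subset_topspace_eq subset_openin_subtopology)
  then have "openin (top_of_set (snd c ` fst c)) (snd c ` U)"
    using homeomorphic_imp_open_map[OF c(2)] open_map_def by blast
  then show ?thesis
    using c(1) openin_open_trans by blast
qed

lemma transition_differentiable:
  assumes "c \<in> charts_at A z" "c' \<in> charts_at A z"
  shows "(snd c' \<circ> chart_inv c) differentiable (at (snd c z))"
proof (rule smooth_on_differentiable)
  show "smooth_on (snd c ` (fst c \<inter> fst c')) (snd c' \<circ> chart_inv c)"
    using assms M unfolding charts_at_def smooth_manifold_def by blast
  show "snd c z \<in> snd c ` (fst c \<inter> fst c')"
    using assms by (simp add: charts_at_def)
qed

lemma transition_derivative_self:
  assumes "c \<in> charts_at A z"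
  shows "frechet_derivative (snd c \<circ> chart_inv c) (at (snd c z)) = (\<lambda>a. a)"
proof -
  have c: "c \<in> A" "z \<in> fst c"
    using assms by (auto simp: charts_at_def)
  have "((\<lambda>p. p) has_derivative (\<lambda>a. a)) (at (snd c z))"
    by (rule has_derivative_ident)
  then have "((snd c \<circ> chart_inv c) has_derivative (\<lambda>a. a)) (at (snd c z))"
  proof (rule has_derivative_transform_within_open)
    show "open (snd c ` fst c)"
      using M c by (auto simp: smooth_manifold_def)
  qed (use c chart_inv_apply[of c] in auto)
  then show ?thesis
    by (rule frechet_derivative_at[symmetric])
qed

text \<open>This is the chain rule for coordinate changes. The composite and the direct change of
  coordinates agree on the image of \<open>fst c1 \<inter> fst c2\<close>, where
  \<open>chart_inv c2\<close> undoes \<open>snd c2\<close>.\<close>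

lemma transition_derivative_cocycle:
  assumes "c1 \<in> charts_at A z" "c2 \<in> charts_at A z" "c3 \<in> charts_at A z"
  shows "frechet_derivative (snd c3 \<circ> chart_inv c2) (at (snd c2 z))
      (frechet_derivative (snd c2 \<circ> chart_inv c1) (at (snd c1 z)) a)
    = frechet_derivative (snd c3 \<circ> chart_inv c1) (at (snd c1 z)) a"
proof -
  have c: "c1 \<in> A" "c2 \<in> A" "z \<in> fst c1" "z \<in> fst c2"
    using assms by (auto simp: charts_at_def)
  have z: "(snd c2 \<circ> chart_inv c1) (snd c1 z) = snd c2 z"
    using c chart_inv_apply by simp
  let ?f = "(snd c3 \<circ> chart_inv c2) \<circ> (snd c2 \<circ> chart_inv c1)"
  have diff: "(snd c2 \<circ> chart_inv c1) differentiable (at (snd c1 z))"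
    "(snd c3 \<circ> chart_inv c2) differentiable (at ((snd c2 \<circ> chart_inv c1) (snd c1 z)))"
    unfolding z by (intro transition_differentiable assms)+
  have comp: "?f differentiable (at (snd c1 z))"
    "frechet_derivative ?f (at (snd c1 z)) =
      frechet_derivative (snd c3 \<circ> chart_inv c2) (at (snd c2 z)) \<circ>
      frechet_derivative (snd c2 \<circ> chart_inv c1) (at (snd c1 z))"
    using differentiable_chain_at[OF diff] frechet_derivative_compose[OF diff] unfolding z .
  have "open (snd c1 ` (fst c1 \<inter> fst c2))"
    using M c by (intro open_chart_image) (auto simp: smooth_manifold_def)
  then have "frechet_derivative ?f (at (snd c1 z)) =
      frechet_derivative (snd c3 \<circ> chart_inv c1) (at (snd c1 z))"
    using c chart_inv_apply[of c1] chart_inv_apply[of c2]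
    by (intro frechet_derivative_transform_within_open[OF comp(1)]) auto
  with comp(2) show ?thesis
    by (metis comp_apply)
qed

section \<open>Linear structure and coordinates of tangent spaces\<close>

lemma tangent_spaceI:
  assumes "\<And>c c'. c \<in> charts_at A z \<Longrightarrow> c' \<in> charts_at A z \<Longrightarrow>
      v c' = frechet_derivative (snd c' \<circ> chart_inv c) (at (snd c z)) (v c)"
    and "\<And>c. c \<notin> charts_at A z \<Longrightarrow> v c = 0"
  shows "v \<in> tangent_space A z"
  using assms unfolding tangent_space_def by blast

lemma tangent_spaceD:
  assumes "v \<in> tangent_space A z"
  shows "c \<in> charts_at A z \<Longrightarrow> c' \<in> charts_at A z \<Longrightarrow>
      frechet_derivative (snd c' \<circ> chart_inv c) (at (snd c z)) (v c) = v c'"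
    and "c \<notin> charts_at A z \<Longrightarrow> v c = 0"
  using assms unfolding tangent_space_def mem_Collect_eq by metis+

lemma tangent_space_tscale:
  assumes "v \<in> tangent_space A z"
  shows "tscale r v \<in> tangent_space A z"
proof (rule tangent_spaceI)
  fix c c' assume c: "c \<in> charts_at A z" "c' \<in> charts_at A z"
  show "tscale r v c' = frechet_derivative (snd c' \<circ> chart_inv c) (at (snd c z)) (tscale r v c)"
    using linear_frechet_derivative[OF transition_differentiable[OF c]]
    by (simp add: tscale_def linear_scale tangent_spaceD(1)[OF assms c])
qed (simp add: tscale_def tangent_spaceD(2)[OF assms])

lemma tangent_space_tzero: "tzero \<in> tangent_space A z"
proof (rule tangent_spaceI)
  fix c c' assume c: "c \<in> charts_at A z" "c' \<in> charts_at A z"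
  show "tzero c' = frechet_derivative (snd c' \<circ> chart_inv c) (at (snd c z)) (tzero c)"
    using linear_frechet_derivative[OF transition_differentiable[OF c]]
    by (simp add: tzero_def linear_0)
qed (simp add: tzero_def)

text \<open>The Jacobians recover every component of a tangent vector from its component in
  \<open>c\<close>, so evaluation at \<open>c\<close> is injective.\<close>

lemma coord_vec_apply:
  assumes "c \<in> charts_at A z" "v \<in> tangent_space A z"
  shows "coord_vec A c z (v c) = v"
proof -
  have "inj_on (\<lambda>v. v c) (tangent_space A z)"
  proof (rule inj_onI)
    fix u w :: "('a, 'e) tvec"
    assume "u \<in> tangent_space A z" "w \<in> tangent_space A z" "u c = w c"
    then show "u = w"
      using tangent_spaceD[of u z] tangent_spaceD[of w z] assms(1) by (metis ext)
  qed
  then show ?thesis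
    using assms(2) inv_into_f_f[of "\<lambda>v. v c"] by (simp add: coord_vec_def)
qed

text \<open>Transporting \<open>a\<close> to all charts by the Jacobians gives a consistent family
  by the cocycle identity. With injectivity, evaluation at \<open>c\<close> is a bijection onto the
  model space.\<close>

lemma coord_vec_in_tangent_space:
  assumes "c \<in> charts_at A z"
  shows "coord_vec A c z a \<in> tangent_space A z" "coord_vec A c z a c = a"
proof -
  define v where "v = (\<lambda>c'. if c' \<in> charts_at A z
    then frechet_derivative (snd c' \<circ> chart_inv c) (at (snd c z)) a else 0)"
  have "v c = a"
    using assms transition_derivative_self[OF assms] by (simp add: v_def)
  moreover have "v \<in> tangent_space A z"
    by (rule tangent_spaceI)
      (simp_all add: v_def transition_derivative_cocycle[OF assms])
  ultimately have v: "v \<in> tangent_space A z" "v c = a"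
    by simp_all
  then have "coord_vec A c z a = v"
    using coord_vec_apply[OF assms] by blast
  with v show "coord_vec A c z a \<in> tangent_space A z" "coord_vec A c z a c = a"
    by simp_all
qed

section \<open>Derivatives along a fibre\<close>

text \<open>The second assumption records which linear chart of the tangent space
  \<open>vderiv\<close> selects; the inverse of that chart is
  \<open>coord_vec A c z\<close>.\<close>

lemma vderiv_tangent_ident:
  assumes "c \<in> charts_at A z"
    and D: "(SOME D. D \<in> charts_at (tangent_space_atlas A z) v) = (tangent_space A z, \<lambda>u. u c)"
  shows "vderiv (tangent_space_atlas A z) G v (tangent_ident A z w) =
    frechet_derivative (G \<circ> coord_vec A c z) (at (v c)) (w c)"
proof -
  have "chart_inv (tangent_space A z, \<lambda>u. u c) = coord_vec A c z"
    by (simp add: fun_eq_iff chart_inv_def coord_vec_def)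
  moreover have "(tangent_space A z, \<lambda>u. u c) \<in> tangent_space_atlas A z"
    using assms(1) by (auto simp: tangent_space_atlas_def)
  ultimately show ?thesis
    unfolding vderiv_def D Let_def by (simp add: tangent_ident_def)
qed

lemma charts_at_tangent_space_atlas:
  assumes "v \<in> tangent_space A z"
  shows "charts_at (tangent_space_atlas A z) v = (\<lambda>c. (tangent_space A z, \<lambda>u. u c)) ` charts_at A z"
  unfolding charts_at_def[of "tangent_space_atlas A z"]
  unfolding tangent_space_atlas_def using assms by auto

text \<open>The selected linear chart depends on the point \<open>v\<close> but not on the map being
  differentiated. One \<open>c\<close> therefore computes the fibre derivatives of all maps, which
  lets the chain rule compare them.\<close>

lemma fibre_deriv_chart:
  assumes "z \<in> topspace X" "v \<in> tangent_space A z"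
  obtains c where "c \<in> charts_at A z"
    "\<And>(G::_ \<Rightarrow> 'b::real_normed_vector) w. fibre_vderiv A z G v w =
      frechet_derivative (G \<circ> coord_vec A c z) (at (v c)) (w c)"
    "\<And>f w c'. c' \<in> charts_at A (f v) \<Longrightarrow> fibre_mderiv A z A f v w c' =
      frechet_derivative (snd c' \<circ> f \<circ> coord_vec A c z) (at (v c)) (w c)"
proof -
  let ?D = "SOME D. D \<in> charts_at (tangent_space_atlas A z) v"
  have "charts_at A z \<noteq> {}"
    using assms(1) M by (auto simp: smooth_manifold_def atlas_carrier_def charts_at_def)
  then have "charts_at (tangent_space_atlas A z) v \<noteq> {}"
    using charts_at_tangent_space_atlas[OF assms(2)] by simp
  then have "?D \<in> charts_at (tangent_space_atlas A z) v"
    using some_in_eq by blast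
  then obtain c where c: "c \<in> charts_at A z" "?D = (tangent_space A z, \<lambda>u. u c)"
    unfolding charts_at_tangent_space_atlas[OF assms(2)] by blast
  show ?thesis
    by (rule that[OF c(1)])
      (simp_all add: fibre_vderiv_def fibre_mderiv_def mderiv_def vderiv_tangent_ident[OF c])
qed

text \<open>In bundle coordinates the fibre over \<open>z\<close> is the affine slice of all pairs
  \<open>(snd c z, a)\<close>. Openness and differentiability of the bundle map pull back along this
  slice.\<close>

lemma bundle_map_fibre_chart:
  assumes R: "Ck_map 1 (tangent_bundle_atlas A) A R"
    and c: "c \<in> charts_at A z" and v: "v \<in> tangent_space A z" and c': "c' \<in> charts_at A (R (z, v))"
  obtains S where "open S" "v c \<in> S" "\<And>a. a \<in> S \<Longrightarrow> R (z, coord_vec A c z a) \<in> fst c'"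
    "(snd c' \<circ> (\<lambda>u. R (z, u)) \<circ> coord_vec A c z) differentiable (at (v c))"
proof -
  \<comment> \<open>\<open>E\<close> is the bundle chart induced by \<open>c\<close>, and
    \<open>U\<close> is the coordinate image of the part of it that \<open>R\<close> sends into the
    domain of \<open>c'\<close>.\<close>
  define E where "E = ({(x, v). x \<in> fst c \<and> v \<in> tangent_space A x}, \<lambda>(x, v::('a, 'e) tvec). (snd c x, v c))"
  define U where "U = snd E ` (fst E \<inter> R -` fst c')"
  have cA: "c \<in> A" "z \<in> fst c" "c' \<in> A" "R (z, v) \<in> fst c'"
    using c c' by (auto simp: charts_at_def)
  have "E \<in> tangent_bundle_atlas A"
    using cA by (auto simp: tangent_bundle_atlas_def E_def)
  then have U: "open U" "\<And>p. p \<in> U \<Longrightarrow> (snd c' \<circ> R \<circ> chart_inv E) differentiable (at p)"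
    using R cA(3) unfolding Ck_map_def U_def One_nat_def Ck_on.simps by blast+
  have "inj_on (snd E) (fst E)"
  proof (rule inj_onI)
    fix p q assume pq: "p \<in> fst E" "q \<in> fst E" "snd E p = snd E q"
    obtain x u y w where xy: "p = (x, u)" "q = (y, w)"
      by fastforce
    then have xuw: "x \<in> fst c" "y \<in> fst c" "snd c x = snd c y" "u c = w c"
      "u \<in> tangent_space A x" "w \<in> tangent_space A y"
      using pq by (auto simp: E_def)
    then have "x = y"
      using chart_inv_apply cA(1) by metis
    moreover have "u = w"
      using xuw coord_vec_apply[of c x] cA(1) \<open>x = y\<close> by (metis (mono_tags, lifting) charts_at_def mem_Collect_eq)
    ultimately show "p = q"
      using xy by simp
  qed
  then have inv: "chart_inv E (snd E p) = p" if "p \<in> fst E" for p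
    using that by (simp add: chart_inv_def)
  have inE: "(z, coord_vec A c z a) \<in> fst E" "snd E (z, coord_vec A c z a) = (snd c z, a)" for a
    using cA c coord_vec_in_tangent_space by (auto simp: E_def)
  have invE: "chart_inv E (snd c z, a) = (z, coord_vec A c z a)" for a
    using inv[OF inE(1)[of a]] inE(2)[of a] by simp
  define S where "S = (\<lambda>a. (snd c z, a)) -` U"
  have "open S"
    unfolding S_def using U(1) by (intro open_vimage) (auto intro!: continuous_intros)
  moreover have vS: "v c \<in> S"
  proof -
    have "snd E (z, v) \<in> U"
      unfolding U_def by (rule imageI) (use cA v in \<open>auto simp: E_def\<close>)
    then show ?thesis
      by (simp add: S_def E_def)
  qed
  moreover have "R (z, coord_vec A c z a) \<in> fst c'" if a: "a \<in> S" for a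
  proof -
    obtain p where p: "p \<in> fst E" "R p \<in> fst c'" "snd E p = (snd c z, a)"
      using a by (auto simp: S_def U_def)
    then have "p = (z, coord_vec A c z a)"
      using inv[OF p(1)] invE[of a] by simp
    with p(2) show ?thesis
      by simp
  qed
  moreover have "(snd c' \<circ> (\<lambda>u. R (z, u)) \<circ> coord_vec A c z) differentiable (at (v c))"
  proof -
    have "(\<lambda>a::'e. (snd c z, a)) differentiable (at (v c))"
      unfolding differentiable_def using has_derivative_Pair[OF has_derivative_const has_derivative_ident] by blast
    moreover have "(snd c' \<circ> R \<circ> chart_inv E) differentiable (at (snd c z, v c))"
      using U(2) vS by (simp add: S_def)
    ultimately have "((snd c' \<circ> R \<circ> chart_inv E) \<circ> (\<lambda>a. (snd c z, a))) differentiable (at (v c))"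
      by (rule differentiable_chain_at)
    then show ?thesis
      by (simp add: comp_def invE)
  qed
  ultimately show ?thesis
    using that by blast
qed

lemma Ck_map_std_atlas_differentiable:
  assumes "Ck_map 1 A std_atlas F" "c \<in> charts_at A z"
  shows "(F \<circ> chart_inv c) differentiable (at (snd c z))"
  using assms by (fastforce simp: Ck_map_def std_atlas_def charts_at_def comp_def)

text \<open>Factoring the coordinate expression through a chart \<open>c'\<close> at
  \<open>R (z, v)\<close> reduces the first claim to the Euclidean chain rule; the second is
  linearity of the derivative.\<close>

lemma fibre_composition_derivative:
  fixes F :: "'a \<Rightarrow> 'b::real_normed_vector"
  assumes F: "Ck_map 1 A std_atlas F" and R: "Ck_map 1 (tangent_bundle_atlas A) A R"
    and z: "z \<in> topspace X" and v: "v \<in> tangent_space A z"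
  shows "fibre_vderiv A z (\<lambda>u. F (R (z, u))) v w =
      vderiv A F (R (z, v)) (fibre_mderiv A z A (\<lambda>u. R (z, u)) v w)" (is ?chain)
    and "fibre_vderiv A z (\<lambda>u. F (R (z, u))) v (tscale r w) =
      r *\<^sub>R fibre_vderiv A z (\<lambda>u. F (R (z, u))) v w" (is ?scale)
proof -
  let ?f = "\<lambda>u. R (z, u)"
  obtain c where c: "c \<in> charts_at A z"
    and vd: "\<And>(G::_ \<Rightarrow> 'b) w. fibre_vderiv A z G v w =
      frechet_derivative (G \<circ> coord_vec A c z) (at (v c)) (w c)"
    and md: "\<And>f w c'. c' \<in> charts_at A (f v) \<Longrightarrow> fibre_mderiv A z A f v w c' =
      frechet_derivative (snd c' \<circ> f \<circ> coord_vec A c z) (at (v c)) (w c)"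
    using fibre_deriv_chart[OF z v, where 'b='b] by metis
  \<comment> \<open>This is the chart that \<open>vderiv\<close> itself selects at
    \<open>R (z, v)\<close>, so both sides are computed in the same coordinates.\<close>
  define c' where "c' = (SOME c. c \<in> charts_at A (R (z, v)))"
  have "(z, v) \<in> atlas_carrier (tangent_bundle_atlas A)"
    using c v by (auto simp: atlas_carrier_def tangent_bundle_atlas_def charts_at_def)
  then have "R (z, v) \<in> atlas_carrier A"
    using R by (auto simp: Ck_map_def)
  then have "charts_at A (R (z, v)) \<noteq> {}"
    by (auto simp: atlas_carrier_def charts_at_def)
  then have c': "c' \<in> charts_at A (R (z, v))"
    using some_in_eq c'_def by blast
  obtain S where S: "open S" "v c \<in> S" "\<And>a. a \<in> S \<Longrightarrow> R (z, coord_vec A c z a) \<in> fst c'"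
    and diff: "(snd c' \<circ> ?f \<circ> coord_vec A c z) differentiable (at (v c))"
    using bundle_map_fibre_chart[OF R c v c'] by metis
  have at: "(snd c' \<circ> ?f \<circ> coord_vec A c z) (v c) = snd c' (R (z, v))"
    using coord_vec_apply[OF c v] by simp
  have diffF: "(F \<circ> chart_inv c') differentiable (at ((snd c' \<circ> ?f \<circ> coord_vec A c z) (v c)))"
    using Ck_map_std_atlas_differentiable[OF F c'] at by simp
  let ?h = "(F \<circ> chart_inv c') \<circ> (snd c' \<circ> ?f \<circ> coord_vec A c z)"
  \<comment> \<open>\<open>?h\<close> inserts \<open>chart_inv c' \<circ> snd c'\<close> between
    \<open>F\<close> and \<open>R\<close>. This leaves values unchanged while \<open>R\<close> stays
    in the domain of \<open>c'\<close>, in particular on the open set \<open>S\<close>.\<close>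
  have h: "?h differentiable (at (v c))"
    using differentiable_chain_at[OF diff diffF] .
  have eq: "?h a = ((\<lambda>u. F (R (z, u))) \<circ> coord_vec A c z) a" if "a \<in> S" for a
    using S(3)[OF that] c' chart_inv_apply by (simp add: charts_at_def)
  have deriv: "frechet_derivative ((\<lambda>u. F (R (z, u))) \<circ> coord_vec A c z) (at (v c)) =
      frechet_derivative ?h (at (v c))"
    using frechet_derivative_transform_within_open[OF h S(1,2) eq] by (rule sym)
  show ?chain
    unfolding vd deriv frechet_derivative_compose[OF diff diffF]
    by (simp add: vderiv_def c'_def[symmetric] Let_def md[of c' ?f, OF c'] at[simplified])
  show ?scale
    unfolding vd deriv using linear_frechet_derivative[OF h]
    by (simp add: tscale_def linear_scale)
qed

section \<open>The metric norm and the Lipschitz estimate along a retraction curve\<close>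

lemma metric_norm_tscale:
  assumes g: "riemannian_metric A g" and z: "z \<in> topspace X" and v: "v \<in> tangent_space A z"
  shows "metric_norm g z (tscale r v) = \<bar>r\<bar> * metric_norm g z v"
proof -
  have zA: "z \<in> atlas_carrier A"
    using z M by (simp add: smooth_manifold_def)
  note rv = tangent_space_tscale[OF v, of r]
  have scale: "g z (tscale r u) w = r * g z u w"
    if "u \<in> tangent_space A z" "w \<in> tangent_space A z" for u w
    using g zA that unfolding riemannian_metric_def by blast
  \<comment> \<open>Homogeneity is given in the first argument of the metric; symmetry moves the
    second factor there.\<close>
  have "g z v (tscale r v) = g z (tscale r v) v"
    using g zA rv v unfolding riemannian_metric_def by blast
  then have "g z (tscale r v) (tscale r v) = r\<^sup>2 * g z v v"
    using scale[OF v rv] scale[OF v v] by (simp add: power2_eq_square)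
  then show ?thesis
    by (simp add: metric_norm_def real_sqrt_mult)
qed

lemma metric_norm_pos:
  assumes "riemannian_metric A g" "z \<in> topspace X" "v \<in> tangent_space A z" "v \<noteq> tzero"
  shows "metric_norm g z v > 0"
proof -
  have "z \<in> atlas_carrier A"
    using assms(2) M by (simp add: smooth_manifold_def)
  then have "g z v v > 0"
    using assms unfolding riemannian_metric_def by blast
  then show ?thesis
    by (simp add: metric_norm_def)
qed

text \<open>At the zero vector the retraction fixes the base point and has identity differential, so
  the chain rule collapses.\<close>

lemma retraction_derivative_tzero:
  assumes "Ck_map 1 A std_atlas F" "manifold_retraction A R" "z \<in> topspace X" "w \<in> tangent_space A z"
  shows "fibre_vderiv A z (\<lambda>u. F (R (z, u))) tzero w = vderiv A F z w"
proof -
  have R1: "Ck_map 1 (tangent_bundle_atlas A) A R"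
    using assms(2) by (simp add: manifold_retraction_def smooth_map_def)
  have z: "z \<in> atlas_carrier A"
    using assms(3) M by (simp add: smooth_manifold_def)
  then have "R (z, tzero) = z" "fibre_mderiv A z A (\<lambda>u. R (z, u)) tzero w = w"
    using assms(2,4) unfolding manifold_retraction_def by blast+
  then show ?thesis
    using fibre_composition_derivative(1)[OF assms(1) R1 assms(3) tangent_space_tzero, of w] by simp
qed

text \<open>Serves to exclude zero search directions, hence division by a zero norm.\<close>

lemma vderiv_tzero:
  assumes "Ck_map 1 A std_atlas F" "z \<in> topspace X"
  shows "vderiv A F z tzero = 0"
proof -
  have "charts_at A z \<noteq> {}"
    using assms(2) M by (auto simp: smooth_manifold_def atlas_carrier_def charts_at_def)
  then have "(SOME c. c \<in> charts_at A z) \<in> charts_at A z"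
    using some_in_eq by blast
  from linear_frechet_derivative[OF Ck_map_std_atlas_differentiable[OF assms(1) this]]
  show ?thesis
    unfolding vderiv_def Let_def tzero_def by (rule linear_0)
qed

text \<open>The Lipschitz hypothesis concerns unit vectors. Normalising \<open>v\<close> yields one
  factor of its norm from linearity in the direction and a second one because time \<open>t\<close>
  along \<open>v\<close> is time \<open>t * N\<close> along the unit vector; hence the
  square.\<close>

lemma retraction_curve_lipschitz:
  fixes F :: "'a \<Rightarrow> 'b::real_normed_vector"
  assumes F: "Ck_map 1 A std_atlas F" and R: "manifold_retraction A R"
    and g: "riemannian_metric A g"
    and z: "z \<in> topspace X" and v: "v \<in> tangent_space A z" "v \<noteq> tzero" and "t \<ge> 0"
    and lip: "\<And>u s. u \<in> tangent_space A z \<Longrightarrow> s \<ge> 0 \<Longrightarrow> metric_norm g z u = 1 \<Longrightarrow>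
      norm (fibre_vderiv A z (\<lambda>u. F (R (z, u))) (tscale s u) u
          - fibre_vderiv A z (\<lambda>u. F (R (z, u))) tzero u) \<le> L * s"
  shows "norm (vderiv A F (R (z, tscale t v)) (fibre_mderiv A z A (\<lambda>u. R (z, u)) (tscale t v) v)
      - vderiv A F z v) \<le> L * t * (metric_norm g z v)\<^sup>2"
proof -
  define N where "N = metric_norm g z v"
  have N: "N > 0"
    unfolding N_def by (rule metric_norm_pos[OF g z v])
  define u where "u = tscale (1 / N) v"
  have u: "u \<in> tangent_space A z" "metric_norm g z u = 1"
    using tangent_space_tscale[OF v(1)] metric_norm_tscale[OF g z v(1)] N
    by (auto simp: u_def N_def)
  have vu: "v = tscale N u" "tscale t v = tscale (t * N) u"
    using N by (auto simp: u_def tscale_def)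
  have R1: "Ck_map 1 (tangent_bundle_atlas A) A R"
    using R by (simp add: manifold_retraction_def smooth_map_def)
  let ?D = "fibre_vderiv A z (\<lambda>u. F (R (z, u)))"
  note tv = tangent_space_tscale[OF v(1), of t]
  have "vderiv A F (R (z, tscale t v)) (fibre_mderiv A z A (\<lambda>u. R (z, u)) (tscale t v) v)
      - vderiv A F z v = ?D (tscale t v) v - ?D tzero v"
    using fibre_composition_derivative(1)[OF F R1 z tv] retraction_derivative_tzero[OF F R z v(1)]
    by simp
  also have "\<dots> = ?D (tscale t v) (tscale N u) - ?D tzero (tscale N u)"
    using vu(1) by simp
  also have "\<dots> = N *\<^sub>R (?D (tscale t v) u - ?D tzero u)"
    unfolding fibre_composition_derivative(2)[OF F R1 z tv]
      fibre_composition_derivative(2)[OF F R1 z tangent_space_tzero]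
    by (simp add: scaleR_diff_right)
  also have "norm \<dots> = N * norm (?D (tscale (t * N) u) u - ?D tzero u)"
    using N vu(2) by simp
  also have "\<dots> \<le> N * (L * (t * N))"
    using N \<open>t \<ge> 0\<close> u by (intro mult_left_mono lip) auto
  finally show ?thesis
    by (simp add: N_def power2_eq_square mult_ac)
qed

end

section \<open>Summability\<close>

lemma zoutendijk_summable:
  fixes p N t f :: "nat \<Rightarrow> real"
  assumes p: "\<And>k. p k < 0" and N: "\<And>k. N k > 0" and "a > 0" "b > 0" "M > 0"
    and step: "\<And>k. b * (- p k) \<le> M * t k * (N k)\<^sup>2"
    and decrease: "\<And>k. f (Suc k) \<le> f k + a * t k * p k"
    and bound: "\<And>k. l \<le> f k"
  shows "summable (\<lambda>k. (p k)\<^sup>2 / (N k)\<^sup>2)"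
proof -
  \<comment> \<open>The factor \<open>1 / a\<close> converts a decrement of \<open>f\<close> into a
    bound on \<open>t k * (- p k)\<close>, and \<open>M / b\<close> comes from \<open>step\<close>
    multiplied by \<open>- p k\<close>. The sequence \<open>q\<close> telescopes.\<close>
  define q where "q k = (M / (b * a)) * (f k - f (Suc k))" for k
  have le: "(p k)\<^sup>2 / (N k)\<^sup>2 \<le> q k" for k
  proof -
    have "b * (p k)\<^sup>2 = (b * (- p k)) * (- p k)"
      by (simp add: power2_eq_square)
    also have "\<dots> \<le> (M * t k * (N k)\<^sup>2) * (- p k)"
      using step p[of k] by (intro mult_right_mono) auto
    finally have "b * ((p k)\<^sup>2 / (N k)\<^sup>2) \<le> M * (t k * (- p k))"
      using N[of k] by (simp add: field_simps)
    then have "(p k)\<^sup>2 / (N k)\<^sup>2 \<le> M / b * (t k * (- p k))"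
      using \<open>b > 0\<close> by (simp add: field_simps)
    also have "\<dots> \<le> M / b * ((f k - f (Suc k)) / a)"
      using decrease[of k] \<open>a > 0\<close> \<open>b > 0\<close> \<open>M > 0\<close>
      by (intro mult_left_mono) (auto simp: field_simps)
    finally show ?thesis
      by (simp add: q_def)
  qed
  have nonneg: "0 \<le> (p k)\<^sup>2 / (N k)\<^sup>2" for k
    by simp
  have "summable q"
  proof (rule bounded_imp_summable)
    show "0 \<le> q k" for k
      using nonneg le order_trans by blast
    show "(\<Sum>k\<le>n. q k) \<le> (M / (b * a)) * (f 0 - l)" for n
    proof -
      have "(\<Sum>k\<le>n. q k) = (M / (b * a)) * (f 0 - f (Suc n))"
        unfolding q_def sum_distrib_left[symmetric] by (simp add: sum_telescope)
      also have "\<dots> \<le> (M / (b * a)) * (f 0 - l)"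
        using bound[of "Suc n"] \<open>a > 0\<close> \<open>b > 0\<close> \<open>M > 0\<close> by (intro mult_left_mono) auto
      finally show ?thesis .
    qed
  qed
  then show ?thesis
    by (rule summable_comparison_test') (use le in simp)
qed

section \<open>The Zoutendijk condition for descent along a retraction\<close>

theorem proposition4p1:
  fixes K C :: "(real ^ 'm) set"
    and e :: "real ^ 'm"
    and c1 c2 :: real
    and X :: "'a topology"
    and A :: "('a, real ^ 'n) chart set"
    and g :: "'a \<Rightarrow> ('a, real ^ 'n) tvec \<Rightarrow> ('a, real ^ 'n) tvec \<Rightarrow> real"
    and F :: "'a \<Rightarrow> real ^ 'm"
    and R :: "'a \<times> ('a, real ^ 'n) tvec \<Rightarrow> 'a"
    and x :: "nat \<Rightarrow> 'a"
    and d :: "nat \<Rightarrow> ('a, real ^ 'n) tvec"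
    and t :: "nat \<Rightarrow> real"
  defines "\<phi> \<equiv> support_fun C"
    and "DF \<equiv> vderiv A F"
    and "sublevel \<equiv> {y \<in> topspace X. cone_le K (F y) (F (x 0))}"
  assumes K: "closed K" "convex K" "cone K" "K \<inter> uminus ` K = {0}" "interior K \<noteq> {}"
    and C: "compact C" "C \<subseteq> dual_cone K - {0}" "dual_cone K = cone hull (convex hull C)"
    and e: "e \<in> K" "\<And>\<omega>. \<omega> \<in> C \<Longrightarrow> 0 < \<omega> \<bullet> e \<and> \<omega> \<bullet> e \<le> 1"
    and c: "0 < c1" "c1 < c2" "c2 < 1"
    and M: "smooth_manifold X A" "riemannian_metric A g"
    and F: "Ck_map 1 A std_atlas F"
    and R: "manifold_retraction A R"
    and seq: "\<And>k. x k \<in> topspace X" "\<And>k. d k \<in> tangent_space A (x k)" "\<And>k. t k > 0"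
      "\<And>k. x (Suc k) = R (x k, tscale (t k) (d k))"
    and lipschitz: "\<exists>L>0. \<forall>y\<in>topspace X. \<forall>v\<in>tangent_space A y. \<forall>s\<ge>0. metric_norm g y v = 1 \<longrightarrow>
      norm (fibre_vderiv A y (\<lambda>u. F (R (y, u))) (tscale s v) v
          - fibre_vderiv A y (\<lambda>u. F (R (y, u))) tzero v) \<le> L * s"
    and bounded_below: "\<And>G :: nat \<Rightarrow> real ^ 'm. (\<And>k. G k \<in> F ` sublevel) \<Longrightarrow>
      (\<And>k. cone_le K (G (Suc k)) (G k)) \<Longrightarrow> \<exists>B. \<forall>k. cone_le K B (G k)"
    and descent: "\<And>k. K_descent_direction A K F (x k) (d k)"
    and wolfe1: "\<And>k. cone_le K (F (R (x k, tscale (t k) (d k))))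
      (F (x k) + (c1 * t k * \<phi> (DF (x k) (d k))) *\<^sub>R e)"
    and wolfe2: "\<And>k. \<phi> (DF (R (x k, tscale (t k) (d k)))
        (fibre_mderiv A (x k) A (\<lambda>u. R (x k, u)) (tscale (t k) (d k)) (d k)))
      \<ge> c2 * \<phi> (DF (x k) (d k))"
  shows "summable (\<lambda>k. (\<phi> (DF (x k) (d k)))\<^sup>2 / (metric_norm g (x k) (d k))\<^sup>2)"
proof -
  \<comment> \<open>The dual cone contains \<open>0\<close>, whereas the cone hull of the empty set
    is empty; hence \<open>C\<close> cannot be empty.\<close>
  have "0 \<in> dual_cone K"
    by (simp add: dual_cone_def)
  moreover have "cone hull {} = ({} :: (real ^ 'm) set)"
    by (simp add: hull_same cone_def)
  ultimately have Cne: "C \<noteq> {}"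
    using C(3) by (metis convex_hull_empty empty_iff)
  then obtain \<omega> where \<omega>: "\<omega> \<in> C"
    by blast
  then have \<omega>K: "\<omega> \<in> dual_cone K"
    using C(2) by blast
  \<comment> \<open>A norm bound on \<open>C\<close> is a Lipschitz constant of
    \<open>\<phi>\<close>.\<close>
  obtain B where B: "B > 0" "\<And>w. w \<in> C \<Longrightarrow> norm w \<le> B"
    using compact_imp_bounded[OF C(1)] bounded_pos by metis
  obtain L where L: "L > 0" "\<forall>y\<in>topspace X. \<forall>v\<in>tangent_space A y. \<forall>s\<ge>0. metric_norm g y v = 1 \<longrightarrow>
      norm (fibre_vderiv A y (\<lambda>u. F (R (y, u))) (tscale s v) v
          - fibre_vderiv A y (\<lambda>u. F (R (y, u))) tzero v) \<le> L * s"
    using lipschitz by blast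
  define p where "p k = \<phi> (DF (x k) (d k))" for k
  define N where "N k = metric_norm g (x k) (d k)" for k
  have p: "p k < 0" for k
    using descent[of k] support_fun_neg[OF C(1) Cne C(2)]
    by (simp add: p_def \<phi>_def DF_def K_descent_direction_def)
  \<comment> \<open>A zero direction would give the value \<open>support_fun C 0 = 0\<close>,
    contradicting the strict descent \<open>p k < 0\<close>.\<close>
  have dne: "d k \<noteq> tzero" for k
  proof
    assume "d k = tzero"
    then have "p k = support_fun C 0"
      using vderiv_tzero[OF M(1) F seq(1)] by (simp add: p_def \<phi>_def DF_def)
    then show False
      using p[of k] Cne by (simp add: support_fun_def)
  qed
  have N: "N k > 0" for k
    unfolding N_def using metric_norm_pos[OF M seq(1,2) dne] .
  have step: "(1 - c2) * (- p k) \<le> (B * L) * t k * (N k)\<^sup>2" for k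
  proof -
    let ?y = "DF (R (x k, tscale (t k) (d k)))
        (fibre_mderiv A (x k) A (\<lambda>u. R (x k, u)) (tscale (t k) (d k)) (d k))"
    \<comment> \<open>By the curvature condition \<open>\<phi>\<close> must rise by at least this
      amount over the step; its Lipschitz bound then forces the step to be long enough.\<close>
    have "(1 - c2) * (- p k) \<le> \<phi> ?y - \<phi> (DF (x k) (d k))"
      using wolfe2[of k] by (simp add: p_def algebra_simps)
    also have "\<dots> \<le> B * norm (?y - DF (x k) (d k))"
      unfolding \<phi>_def by (rule support_fun_diff_le[OF C(1) Cne B(2)])
    also have "\<dots> \<le> B * (L * t k * (N k)\<^sup>2)"
      unfolding DF_def N_def
      using B(1) L(2) seq(1)[of k] seq(3)[of k]
      by (intro mult_left_mono retraction_curve_lipschitz[OF M(1) F R M(2) seq(1,2) dne]) auto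
    finally show ?thesis
      by (simp add: mult_ac)
  qed
  have wolfe1': "cone_le K (F (x (Suc k))) (F (x k) + (c1 * t k * p k) *\<^sub>R e)" for k
    using wolfe1[of k] by (simp add: seq(4) p_def)
  have mono: "cone_le K (F (x (Suc k))) (F (x k))" for k
  proof (rule cone_le_trans[OF K(2,3) wolfe1'])
    have "(- (c1 * t k * p k)) *\<^sub>R e \<in> K"
      using c(1) seq(3)[of k] p[of k] e(1) K(3)
      by (intro mem_cone) (auto simp: mult_nonneg_nonpos)
    then show "cone_le K (F (x k) + (c1 * t k * p k) *\<^sub>R e) (F (x k))"
      by (simp add: cone_le_def)
  qed
  \<comment> \<open>The iterates stay in the sublevel set, so the order-boundedness hypothesis
    applies to the decreasing sequence of their values.\<close>
  have "cone_le K (F (x k)) (F (x 0))" for k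
  proof (induction k)
    case 0
    have "0 \<in> K"
      using K(4) by blast
    then show ?case
      by (simp add: cone_le_def)
  next
    case (Suc k)
    then show ?case
      using cone_le_trans[OF K(2,3) mono] by blast
  qed
  then have "F (x k) \<in> F ` sublevel" for k
    using seq(1) by (auto simp: sublevel_def)
  then obtain l where l: "\<And>k. cone_le K l (F (x k))"
    using bounded_below[of "\<lambda>k. F (x k)"] mono by blast
  have "summable (\<lambda>k. (p k)\<^sup>2 / (N k)\<^sup>2)"
  proof (rule zoutendijk_summable[OF p N])
    \<comment> \<open>The constants are \<open>a = c1 * (\<omega> \<bullet> e)\<close> from
      sufficient decrease paired with \<omega>, \<open>b = 1 - c2\<close> from curvature, and
      \<open>M = B * L\<close> from the two Lipschitz bounds.\<close>
    show "0 < c1 * (\<omega> \<bullet> e)" "0 < 1 - c2" "0 < B * L"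
      using c e(2)[OF \<omega>] B(1) L(1) by auto
    show "(1 - c2) * (- p k) \<le> (B * L) * t k * (N k)\<^sup>2" for k
      by (rule step)
    show "\<omega> \<bullet> F (x (Suc k)) \<le> \<omega> \<bullet> F (x k) + c1 * (\<omega> \<bullet> e) * t k * p k" for k
      using cone_le_inner[OF \<omega>K wolfe1'[of k]] by (simp add: inner_add_right mult_ac)
    show "\<omega> \<bullet> l \<le> \<omega> \<bullet> F (x k)" for k
      by (rule cone_le_inner[OF \<omega>K l])
  qed
  then show ?thesis
    by (simp add: p_def N_def)
qed

end
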